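(* Let $A\in\mathbb{R}^{m\times n}$ and $(\bar b,\bar\lambda)\in\mathbb{R}^m\times\mathbb{R}_{++}$. Let $S(b,\lambda):=\mathrm{argmin}_{x\in\mathbb{R}^n}\{\frac12\|Ax-b\|^2+\lambda\|x\|_1\}$ be the solution mapping of the LASSO problem, let $\bar x\in S(\bar b,\bar\lambda)$, and set $$J_{LA}:=\{i\in[n]:|A_i^T(\bar b-A\bar x)|=\bar\lambda\}.$$ Then $S$ is locally single-valued and Lipschitz around $(\bar b,\bar\lambda)$ if and only if $A_{J_{LA}}$ has full column rank, or equivalently $\ker(A_{J_{LA}})=\{0\}$.
   Context: $\mathbb{R}_{++}=(0,\infty)$, $[n]=\{1,\dots,n\}$; $\|\cdot\|$ is the Euclidean norm and $\|\cdot\|_1$ the $\ell_1$-norm. $A_i$ is the $i$-th column of $A$; for $I\subset[n]$, $A_I$ is the submatrix of columns of $A$ indexed by $I$ (for $I=\emptyset$ it is regarded as having full column rank, i.e. trivial kernel). "Locally single-valued and Lipschitz around $(\bar b,\bar\lambda)$" means that there is a neighborhood of $(\bar b,\bar\lambda)$ on which $S(b,\lambda)$ is a singleton and, as a function, $S$ is Lipschitz continuous. *)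

theory Defs
  imports "HOL-Analysis.Analysis"
begin

definition l1_norm :: "real ^ 'n \<Rightarrow> real" where
  "l1_norm x = (\<Sum>i\<in>UNIV. \<bar>x $ i\<bar>)"

definition lasso_objective ::
    "real ^ 'n ^ 'm \<Rightarrow> real ^ 'm \<Rightarrow> real \<Rightarrow> real ^ 'n \<Rightarrow> real" where
  "lasso_objective A b l x = 1 / 2 * (norm (A *v x - b))\<^sup>2 + l * l1_norm x"

text \<open>The parameter space is \<^term>\<open>UNIV \<times> {0<..}\<close>; values of the solution mapping at
  pairs \<open>(b, l)\<close> with \<open>l \<le> 0\<close> are never used.\<close>

definition lasso_sol ::
    "real ^ 'n ^ 'm \<Rightarrow> (real ^ 'm) \<times> real \<Rightarrow> (real ^ 'n) set" where
  "lasso_sol A = (\<lambda>(b, l). {x. is_arg_min (lasso_objective A b l) (\<lambda>_. True) x})"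

definition locally_single_valued_lipschitz ::
    "'p::metric_space set \<Rightarrow> ('p \<Rightarrow> 'q::metric_space set) \<Rightarrow> 'p \<Rightarrow> bool" where
  "locally_single_valued_lipschitz D S p \<longleftrightarrow>
     (\<exists>U s L. open U \<and> p \<in> U \<and> U \<subseteq> D \<and> (\<forall>q\<in>U. S q = {s q}) \<and> L-lipschitz_on U s)"

definition J_LA :: "real ^ 'n ^ 'm \<Rightarrow> real ^ 'm \<Rightarrow> real \<Rightarrow> real ^ 'n \<Rightarrow> 'n set" where
  "J_LA A b l x = {i. \<bar>column i A \<bullet> (b - A *v x)\<bar> = l}"

text \<open>The number of columns of the submatrix of \<open>A\<close> with columns in \<open>I\<close> is not a type, so the
  submatrix is represented by the family of its columns, indexed by \<open>I\<close>, and \<open>\<real>\<^sup>I\<close> by the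
  extensional functions \<^term>\<open>I \<rightarrow>\<^sub>E (UNIV :: real set)\<close>. Rank is the dimension of the column
  space; comparing it with \<^term>\<open>card I\<close> counts repeated columns with multiplicity.\<close>

definition col_submatrix :: "real ^ 'n ^ 'm \<Rightarrow> 'n set \<Rightarrow> 'n \<Rightarrow> real ^ 'm" where
  "col_submatrix A I = (\<lambda>i\<in>I. column i A)"

definition full_column_rank :: "real ^ 'n ^ 'm \<Rightarrow> 'n set \<Rightarrow> bool" where
  "full_column_rank A I \<longleftrightarrow> dim (span (col_submatrix A I ` I)) = card I"

definition col_submatrix_kernel :: "real ^ 'n ^ 'm \<Rightarrow> 'n set \<Rightarrow> ('n \<Rightarrow> real) set" where
  "col_submatrix_kernel A I =
     {y \<in> I \<rightarrow>\<^sub>E UNIV. (\<Sum>i\<in>I. y i *\<^sub>R col_submatrix A I i) = 0}"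

end

theory Submission
  imports Defs
begin

text \<open>
  Write \<open>J\<close> for the index set \<open>J_LA A b0 l0 x0\<close>. Full column rank of the submatrix \<open>A\<^sub>J\<close> and
  triviality of its kernel both say that \<open>A\<close> is injective on the subspace of vectors supported
  on \<open>J\<close> (\<open>full_column_rank_iff\<close>, \<open>kernel_trivial_iff\<close>); the proof works with this form.
  Everything else rests on the optimality conditions of the LASSO, once as a variational
  inequality (\<open>lasso_sol_variational\<close>) and once coordinatewise (\<open>lasso_sol_coordinatewise\<close>).

  Suppose that \<open>A\<close> is injective on vectors supported on \<open>J\<close>. Adding the variational inequalities
  of two solutions \<open>x\<close>, \<open>x'\<close> for parameters \<open>(b, l)\<close>, \<open>(b', l')\<close> bounds \<open>|A(x - x')|\<^sup>2\<close> by
  \<open>|b - b'| |A(x - x')|\<close> plus \<open>|l - l'|\<close> times the difference of the l1-norms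
  (\<open>lasso_sol_monotonicity\<close>). Since solutions stay bounded, it follows that \<open>A x\<close> tends to
  \<open>A x0\<close> as the parameters tend to \<open>(b0, l0)\<close>, although \<open>x\<close> itself is not yet controlled.
  The strict inequalities \<open>|A\<^sub>i\<^sup>T(b0 - A x0)| < l0\<close> for \<open>i \<notin> J\<close> therefore persist, and
  they force nearby solutions to be supported on \<open>J\<close> (\<open>eventually_lasso_support\<close>). There
  \<open>|A d| \<ge> c |d|\<close> with \<open>c > 0\<close>, and the same bound turns into a Lipschitz estimate, which for
  equal parameters gives uniqueness.

  Conversely, let \<open>d\<close> be supported on \<open>J\<close> with \<open>A d = 0\<close>. Let \<open>w\<close> carry on \<open>J\<close> the signs of
  \<open>A\<^sub>i\<^sup>T(b0 - A x0)\<close>. Replacing \<open>x0\<close> by \<open>x0 + t w\<close> and \<open>b0\<close> by \<open>b0 + t A w\<close> leaves the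
  residual unchanged, so the optimality conditions still hold, but now every coordinate in
  \<open>J\<close> is at least \<open>t\<close> in modulus and has the sign required by these conditions. A small multiple
  of \<open>d\<close> can thus be added without losing optimality. The parameters are arbitrarily close to
  \<open>(b0, l0)\<close>, so single-valuedness forces \<open>d = 0\<close>
  (\<open>kernel_trivial_if_lasso_sol_singleton\<close>).
\<close>

section \<open>The l1-norm\<close>

lemma l1_norm_nonneg: "0 \<le> l1_norm x"
  by (simp add: l1_norm_def sum_nonneg)

lemma l1_norm_zero [simp]: "l1_norm 0 = 0"
  by (simp add: l1_norm_def)

lemma norm_le_l1_norm: "norm x \<le> l1_norm x"
  unfolding l1_norm_def by (rule norm_le_l1_cart)

lemma l1_norm_le_card_norm: "l1_norm (x :: real ^ 'n) \<le> real CARD('n) * norm x"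
proof -
  have "l1_norm x \<le> (\<Sum>i\<in>(UNIV :: 'n set). norm x)"
    unfolding l1_norm_def by (intro sum_mono component_le_norm_cart)
  then show ?thesis by simp
qed

lemma abs_l1_norm_diff_le: "\<bar>l1_norm x - l1_norm y\<bar> \<le> l1_norm (x - y)"
proof -
  have "\<bar>l1_norm x - l1_norm y\<bar> = \<bar>\<Sum>i\<in>UNIV. \<bar>x $ i\<bar> - \<bar>y $ i\<bar>\<bar>"
    by (simp add: l1_norm_def sum_subtractf)
  also have "\<dots> \<le> (\<Sum>i\<in>UNIV. \<bar>\<bar>x $ i\<bar> - \<bar>y $ i\<bar>\<bar>)"
    by (rule sum_abs)
  also have "\<dots> \<le> l1_norm (x - y)"
    unfolding l1_norm_def by (intro sum_mono) (simp add: abs_triangle_ineq3)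
  finally show ?thesis .
qed

lemma l1_norm_segment_le:
  assumes "0 \<le> t" "t \<le> 1"
  shows "l1_norm (x + t *\<^sub>R (y - x)) \<le> l1_norm x + t * (l1_norm y - l1_norm x)"
proof -
  have "\<bar>x $ i + t * (y $ i - x $ i)\<bar> \<le> \<bar>x $ i\<bar> + t * (\<bar>y $ i\<bar> - \<bar>x $ i\<bar>)" for i
  proof -
    have "\<bar>x $ i + t * (y $ i - x $ i)\<bar> = \<bar>(1 - t) * x $ i + t * y $ i\<bar>"
      by (simp add: algebra_simps)
    also have "\<dots> \<le> \<bar>(1 - t) * x $ i\<bar> + \<bar>t * y $ i\<bar>"
      by (rule abs_triangle_ineq)
    also have "\<dots> = (1 - t) * \<bar>x $ i\<bar> + t * \<bar>y $ i\<bar>"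
      unfolding abs_mult using assms by simp
    also have "\<dots> = \<bar>x $ i\<bar> + t * (\<bar>y $ i\<bar> - \<bar>x $ i\<bar>)"
      by (simp add: algebra_simps)
    finally show ?thesis .
  qed
  then have "l1_norm (x + t *\<^sub>R (y - x)) \<le> (\<Sum>i\<in>UNIV. \<bar>x $ i\<bar> + t * (\<bar>y $ i\<bar> - \<bar>x $ i\<bar>))"
    unfolding l1_norm_def by (intro sum_mono) simp
  also have "\<dots> = l1_norm x + t * (l1_norm y - l1_norm x)"
    by (simp add: l1_norm_def sum.distrib sum_distrib_left[symmetric] sum_subtractf)
  finally show ?thesis .
qed

section \<open>Optimality conditions\<close>

lemma lasso_sol_iff:
  "x \<in> lasso_sol A (b, l) \<longleftrightarrow> (\<forall>y. lasso_objective A b l x \<le> lasso_objective A b l y)"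
  by (auto simp: lasso_sol_def is_arg_min_linorder)

text \<open>The quadratic part is expanded exactly around \<open>x\<close>; only the l1-part is left unexpanded.
  Both directions of the variational inequality are read off from this identity.\<close>

lemma lasso_objective_expand:
  "lasso_objective A b l y - lasso_objective A b l x =
     1 / 2 * (norm (A *v (y - x)))\<^sup>2 - (b - A *v x) \<bullet> (A *v (y - x))
       + l * (l1_norm y - l1_norm x)"
proof -
  have "A *v y - b = A *v (y - x) - (b - A *v x)"
    by (simp add: matrix_vector_mult_diff_distrib)
  moreover have "(norm (A *v x - b))\<^sup>2 = (norm (b - A *v x))\<^sup>2"
    by (simp add: norm_minus_commute)
  ultimately show ?thesis
    by (simp add: lasso_objective_def power2_norm_eq_inner inner_diff_left inner_diff_right
        inner_commute algebra_simps)
qed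

text \<open>For a minimizer \<open>x\<close>, the objective does not decrease along the segment towards \<open>y\<close>. By
  convexity of the l1-norm the increment at \<open>x + t (y - x)\<close> is at most \<open>t\<close> times the linearized
  gap plus a term quadratic in \<open>t\<close>; dividing by \<open>t\<close> and letting \<open>t \<rightarrow> 0\<close> removes the quadratic
  term. Conversely, that term is nonnegative.\<close>

lemma lasso_sol_variational:
  assumes "l > 0"
  shows "x \<in> lasso_sol A (b, l) \<longleftrightarrow>
    (\<forall>y. (b - A *v x) \<bullet> (A *v (y - x)) \<le> l * (l1_norm y - l1_norm x))"
proof
  assume x: "x \<in> lasso_sol A (b, l)"
  show "\<forall>y. (b - A *v x) \<bullet> (A *v (y - x)) \<le> l * (l1_norm y - l1_norm x)"
  proof
    fix y
    define N where "N = 1 / 2 * (norm (A *v (y - x)))\<^sup>2"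
    define G where "G = (b - A *v x) \<bullet> (A *v (y - x)) - l * (l1_norm y - l1_norm x)"
    have "G \<le> t * N" if t: "0 < t" "t < 1" for t
    proof -
      have d: "(x + t *\<^sub>R (y - x)) - x = t *\<^sub>R (y - x)" by simp
      have "0 \<le> lasso_objective A b l (x + t *\<^sub>R (y - x)) - lasso_objective A b l x"
        using x by (simp add: lasso_sol_iff)
      also have "\<dots> = t\<^sup>2 * N - t * ((b - A *v x) \<bullet> (A *v (y - x)))
          + l * (l1_norm (x + t *\<^sub>R (y - x)) - l1_norm x)"
        unfolding lasso_objective_expand d N_def
        by (simp add: matrix_vector_mult_scaleR power_mult_distrib)
      also have "\<dots> \<le> t\<^sup>2 * N - t * ((b - A *v x) \<bullet> (A *v (y - x)))
          + l * (t * (l1_norm y - l1_norm x))"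
        using l1_norm_segment_le[of t x y] t assms by simp
      also have "\<dots> = t * (t * N - G)"
        by (simp add: G_def power2_eq_square algebra_simps)
      finally show ?thesis using t by (simp add: zero_le_mult_iff)
    qed
    then have ev: "\<forall>\<^sub>F t in at_right 0. G \<le> t * N"
      using eventually_at_right_real[of 0 "1::real"] by (auto elim!: eventually_mono)
    have "((\<lambda>t. t * N) \<longlongrightarrow> 0 * N) (at_right 0)"
      by (intro tendsto_intros)
    from tendsto_lowerbound[OF this ev] have "G \<le> 0" by simp
    then show "(b - A *v x) \<bullet> (A *v (y - x)) \<le> l * (l1_norm y - l1_norm x)"
      by (simp add: G_def)
  qed
next
  assume *: "\<forall>y. (b - A *v x) \<bullet> (A *v (y - x)) \<le> l * (l1_norm y - l1_norm x)"
  show "x \<in> lasso_sol A (b, l)"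
    unfolding lasso_sol_iff
  proof
    fix y
    have "0 \<le> (norm (A *v (y - x)))\<^sup>2" by simp
    with *[rule_format, of y] lasso_objective_expand[of A b l y x]
    show "lasso_objective A b l x \<le> lasso_objective A b l y"
      by linarith
  qed
qed

lemma inner_matrix_vector_mult_columns:
  "r \<bullet> (A *v d) = (\<Sum>i\<in>UNIV. d $ i * (column i A \<bullet> r))"
  by (simp add: matrix_mult_sum inner_sum_right scalar_mult_eq_scaleR inner_commute)

lemma mult_le_mult_abs:
  fixes p s l :: real
  assumes "\<bar>p\<bar> \<le> l"
  shows "s * p \<le> l * \<bar>s\<bar>"
proof -
  have "s * p \<le> \<bar>p\<bar> * \<bar>s\<bar>" by (metis abs_ge_self abs_mult mult.commute)
  also have "\<dots> \<le> l * \<bar>s\<bar>" using assms by (intro mult_right_mono) auto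
  finally show ?thesis .
qed

text \<open>This is \<open>A\<^sup>T(b - A x) \<in> l \<partial>|x|\<^sub>1\<close>: the correlation of column \<open>i\<close> with the residual
  is \<open>l\<close> times a subgradient of the absolute value at \<open>x\<^sub>i\<close>. The product equation encodes the sign
  condition at \<open>x\<^sub>i \<noteq> 0\<close> without a case distinction. Necessity tests the variational inequality
  with \<open>y = x + s e\<^sub>i\<close>; the values \<open>s = \<plusminus>1\<close> give the bound and \<open>s = -x\<^sub>i\<close>
  gives the equation.\<close>

lemma lasso_sol_coordinatewise:
  assumes l: "l > 0"
  shows "x \<in> lasso_sol A (b, l) \<longleftrightarrow>
    (\<forall>i. \<bar>column i A \<bullet> (b - A *v x)\<bar> \<le> l \<and>
         x $ i * (column i A \<bullet> (b - A *v x)) = l * \<bar>x $ i\<bar>)"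
proof -
  define p where "p i = column i A \<bullet> (b - A *v x)" for i
  have inner: "(b - A *v x) \<bullet> (A *v d) = (\<Sum>i\<in>UNIV. d $ i * p i)" for d
    by (simp add: inner_matrix_vector_mult_columns p_def)
  show ?thesis
    unfolding lasso_sol_variational[OF l] p_def[symmetric]
  proof (intro iffI allI)
    fix i
    assume *: "\<forall>y. (b - A *v x) \<bullet> (A *v (y - x)) \<le> l * (l1_norm y - l1_norm x)"
    have step: "s * p i \<le> l * (\<bar>x $ i + s\<bar> - \<bar>x $ i\<bar>)" for s
    proof -
      have "(b - A *v x) \<bullet> (A *v ((x + axis i s) - x)) = s * p i"
        by (simp add: inner axis_def if_distrib[of "\<lambda>u. u * _"] cong: if_cong)
      moreover have "l1_norm (x + axis i s) - l1_norm x = \<bar>x $ i + s\<bar> - \<bar>x $ i\<bar>"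
      proof -
        have "l1_norm (x + axis i s) - l1_norm x
            = (\<Sum>j\<in>UNIV. if j = i then \<bar>x $ i + s\<bar> - \<bar>x $ i\<bar> else 0)"
          unfolding l1_norm_def sum_subtractf[symmetric]
          by (intro sum.cong) (auto simp: axis_def)
        then show ?thesis by simp
      qed
      ultimately show ?thesis using *[rule_format, of "x + axis i s"] by simp
    qed
    have "l * (\<bar>x $ i + 1\<bar> - \<bar>x $ i\<bar>) \<le> l * 1" "l * (\<bar>x $ i + (-1)\<bar> - \<bar>x $ i\<bar>) \<le> l * 1"
      using l by (intro mult_left_mono; linarith)+
    with step[of 1] step[of "-1"] have bound: "\<bar>p i\<bar> \<le> l" by linarith
    moreover have "x $ i * p i \<le> l * \<bar>x $ i\<bar>"
      by (rule mult_le_mult_abs[OF bound])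
    then have "x $ i * p i = l * \<bar>x $ i\<bar>"
      using step[of "- x $ i"] by simp
    ultimately show "\<bar>p i\<bar> \<le> l \<and> x $ i * p i = l * \<bar>x $ i\<bar>" by blast
  next
    fix y
    assume *: "\<forall>i. \<bar>p i\<bar> \<le> l \<and> x $ i * p i = l * \<bar>x $ i\<bar>"
    have "(y - x) $ i * p i \<le> l * (\<bar>y $ i\<bar> - \<bar>x $ i\<bar>)" for i
    proof -
      have "y $ i * p i \<le> l * \<bar>y $ i\<bar>"
        using * by (intro mult_le_mult_abs) auto
      with * show ?thesis by (simp add: algebra_simps)
    qed
    then have "(\<Sum>i\<in>UNIV. (y - x) $ i * p i) \<le> (\<Sum>i\<in>UNIV. l * (\<bar>y $ i\<bar> - \<bar>x $ i\<bar>))"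
      by (intro sum_mono)
    then show "(b - A *v x) \<bullet> (A *v (y - x)) \<le> l * (l1_norm y - l1_norm x)"
      by (simp add: inner l1_norm_def sum_distrib_left[symmetric] sum_subtractf)
  qed
qed

section \<open>Existence and a priori bounds\<close>

lemma lasso_objective_ge_l1: "l * l1_norm x \<le> lasso_objective A b l x"
  by (simp add: lasso_objective_def)

lemma lasso_objective_zero: "lasso_objective A b l 0 = (norm b)\<^sup>2 / 2"
  by (simp add: lasso_objective_def)

lemma continuous_on_lasso_objective: "continuous_on S (lasso_objective A b l)"
  unfolding lasso_objective_def [abs_def] l1_norm_def
  by (intro continuous_intros matrix_vector_mult_linear_continuous_on)

text \<open>A minimizer over the ball of radius \<open>|b|\<^sup>2 / (2 l)\<close> is a global one, because the penalty
  alone makes the objective outside this ball larger than its value at \<open>0\<close>.\<close>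

lemma lasso_sol_nonempty:
  assumes l: "l > 0"
  shows "lasso_sol A (b, l) \<noteq> {}"
proof -
  define R where "R = (norm b)\<^sup>2 / (2 * l)"
  have R: "0 \<le> R" using l by (simp add: R_def)
  obtain x where x: "x \<in> cball 0 R"
    "\<forall>y\<in>cball 0 R. lasso_objective A b l x \<le> lasso_objective A b l y"
    using continuous_attains_inf[OF compact_cball _ continuous_on_lasso_objective, of 0 R A b l] R
    by auto
  have "lasso_objective A b l x \<le> lasso_objective A b l y" for y
  proof (cases "y \<in> cball 0 R")
    case False
    have "lasso_objective A b l x \<le> lasso_objective A b l 0"
      using x R by simp
    also have "\<dots> = l * R" using l by (simp add: lasso_objective_zero R_def)
    also have "\<dots> \<le> l * l1_norm y"
      using False l norm_le_l1_norm[of y] by simp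
    also have "\<dots> \<le> lasso_objective A b l y" by (rule lasso_objective_ge_l1)
    finally show ?thesis .
  qed (use x in blast)
  then have "x \<in> lasso_sol A (b, l)" by (simp add: lasso_sol_iff)
  then show ?thesis by blast
qed

text \<open>Comparison with the objective value at \<open>0\<close>.\<close>

lemma lasso_sol_l1_norm_le:
  assumes "l > 0" "x \<in> lasso_sol A (b, l)"
  shows "l1_norm x \<le> (norm b)\<^sup>2 / (2 * l)"
proof -
  have "l * l1_norm x \<le> (norm b)\<^sup>2 / 2"
    using assms(2) lasso_objective_ge_l1[of l x A b]
    unfolding lasso_sol_iff lasso_objective_zero[of A b l, symmetric] by (meson order_trans)
  then show ?thesis using assms(1) by (simp add: field_simps)
qed

section \<open>Stability of solutions\<close>

text \<open>The variational inequality at \<open>x\<close> is tested with \<open>x'\<close> and vice versa. In the sum the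
  l1-terms cancel up to the factor \<open>l - l'\<close>; this is monotonicity of the subdifferential.\<close>

lemma lasso_sol_monotonicity:
  assumes "l > 0" "x \<in> lasso_sol A (b, l)" "l' > 0" "x' \<in> lasso_sol A (b', l')"
  shows "(norm (A *v (x - x')))\<^sup>2
     \<le> norm (b - b') * norm (A *v (x - x')) + \<bar>l - l'\<bar> * \<bar>l1_norm x - l1_norm x'\<bar>"
proof -
  have 1: "(b - A *v x) \<bullet> (A *v (x' - x)) \<le> l * (l1_norm x' - l1_norm x)"
    using assms lasso_sol_variational by blast
  have 2: "(b' - A *v x') \<bullet> (A *v (x - x')) \<le> l' * (l1_norm x - l1_norm x')"
    using assms lasso_sol_variational by blast
  have "(norm (A *v (x - x')))\<^sup>2
      = (b - A *v x) \<bullet> (A *v (x' - x)) + (b' - A *v x') \<bullet> (A *v (x - x'))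
        + (b - b') \<bullet> (A *v (x - x'))"
    by (simp add: power2_norm_eq_inner matrix_vector_mult_diff_distrib
        inner_diff_left inner_diff_right inner_commute algebra_simps)
  also have "\<dots> \<le> (l' - l) * (l1_norm x - l1_norm x') + (b - b') \<bullet> (A *v (x - x'))"
    using 1 2 by (simp add: algebra_simps)
  also have "\<dots> \<le> \<bar>l - l'\<bar> * \<bar>l1_norm x - l1_norm x'\<bar> + norm (b - b') * norm (A *v (x - x'))"
    by (intro add_mono norm_cauchy_schwarz)
      (metis abs_ge_self abs_minus_commute abs_mult)
  finally show ?thesis by simp
qed

lemma less_if_square_le_affine:
  fixes t :: real
  assumes "t\<^sup>2 \<le> \<beta> * t + \<gamma>" "\<beta> + \<gamma> / \<eta> < \<eta>" "0 < \<eta>" "0 \<le> \<gamma>"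
  shows "t < \<eta>"
proof (rule ccontr)
  assume "\<not> t < \<eta>"
  then have t: "\<eta> \<le> t" "0 < t" using assms by auto
  have "\<gamma> / \<eta> * \<eta> \<le> \<gamma> / \<eta> * t"
    using assms t by (intro mult_left_mono) auto
  then have "\<gamma> \<le> \<gamma> / \<eta> * t" using assms by simp
  with assms(1) have "t * t \<le> (\<beta> + \<gamma> / \<eta>) * t"
    by (simp add: power2_eq_square algebra_simps)
  with t assms(2) show False by simp
qed

lemma eventually_snd_pos:
  fixes l0 :: real
  assumes "l0 > 0"
  shows "\<forall>\<^sub>F q in nhds (b0, l0). snd q > 0"
  using order_tendstoD(1)[OF tendsto_snd[OF filterlim_ident[of "nhds (b0, l0)"]], of 0] assms
  by simp

text \<open>Distinct solutions for one parameter have the same image under \<open>A\<close>, and this image depends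
  continuously on the parameter. The monotonicity bound, with the
  a priori bound on the l1-norm inserted, is a quadratic inequality for \<open>|A(x - x0)|\<close> whose
  coefficients vanish at \<open>(b0, l0)\<close>.\<close>

lemma eventually_lasso_image_near:
  assumes l0: "l0 > 0" and x0: "x0 \<in> lasso_sol A (b0, l0)" and \<eta>: "\<eta> > 0"
  shows "\<forall>\<^sub>F q in nhds (b0, l0). \<forall>x\<in>lasso_sol A q. norm (A *v (x - x0)) < \<eta>"
proof -
  \<comment> \<open>The quantity \<open>\<beta> + \<gamma> / \<eta>\<close> of \<open>less_if_square_le_affine\<close>, as a function of the parameter.\<close>
  define g where "g q = norm (fst q - b0)
     + \<bar>snd q - l0\<bar> * ((norm (fst q))\<^sup>2 / (2 * snd q) + l1_norm x0) / \<eta>" for q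
  have "(g \<longlongrightarrow> norm (fst (b0, l0) - b0) + \<bar>snd (b0, l0) - l0\<bar>
      * ((norm (fst (b0, l0)))\<^sup>2 / (2 * snd (b0, l0)) + l1_norm x0) / \<eta>) (nhds (b0, l0))"
    unfolding g_def [abs_def]
    by (intro tendsto_intros filterlim_ident) (use l0 \<eta> in auto)
  then have "(g \<longlongrightarrow> 0) (nhds (b0, l0))" by simp
  then have "\<forall>\<^sub>F q in nhds (b0, l0). g q < \<eta>" using \<eta> by (rule order_tendstoD)
  moreover note eventually_snd_pos[OF l0, of b0]
  ultimately show ?thesis
  proof eventually_elim
    case (elim q)
    obtain b l where q: "q = (b, l)" by fastforce
    show ?case
    proof
      fix x assume x: "x \<in> lasso_sol A q"
      have l: "l > 0" using elim q by simp
      define M where "M = (norm b)\<^sup>2 / (2 * l) + l1_norm x0"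
      have xM: "\<bar>l1_norm x - l1_norm x0\<bar> \<le> M"
        using lasso_sol_l1_norm_le[OF l] x l1_norm_nonneg[of x] l1_norm_nonneg[of x0]
        unfolding M_def q by (smt (verit, best))
      have "(norm (A *v (x - x0)))\<^sup>2
          \<le> norm (b - b0) * norm (A *v (x - x0)) + \<bar>l - l0\<bar> * \<bar>l1_norm x - l1_norm x0\<bar>"
        using lasso_sol_monotonicity[OF l _ l0 x0] x q by blast
      also have "\<dots> \<le> norm (b - b0) * norm (A *v (x - x0)) + \<bar>l - l0\<bar> * M"
        using xM by (simp add: mult_left_mono)
      finally show "norm (A *v (x - x0)) < \<eta>"
        using less_if_square_le_affine[OF _ _ \<eta>] elim(1) xM by (simp add: g_def q M_def)
    qed
  qed
qed

text \<open>A column outside \<open>J_LA\<close> has correlation strictly below \<open>l0\<close> with the residual at \<open>x0\<close>.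
  Residuals of nearby solutions are close to this one, so the strict inequality persists, and by
  the coordinatewise conditions the coordinate then vanishes. There are finitely many columns.\<close>

lemma eventually_lasso_support:
  assumes l0: "l0 > 0" and x0: "x0 \<in> lasso_sol A (b0, l0)"
  shows "\<forall>\<^sub>F q in nhds (b0, l0). \<forall>x\<in>lasso_sol A q. \<forall>i. i \<notin> J_LA A b0 l0 x0 \<longrightarrow> x $ i = 0"
proof -
  have "\<forall>\<^sub>F q in nhds (b0, l0). \<forall>x\<in>lasso_sol A q. x $ i = 0"
    if i: "i \<notin> J_LA A b0 l0 x0" for i
  proof -
    define a where "a = column i A"
    define p where "p = \<bar>a \<bullet> (b0 - A *v x0)\<bar>"
    have "p \<le> l0" using x0 unfolding lasso_sol_coordinatewise[OF l0] p_def a_def by blast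
    moreover have "p \<noteq> l0" using i by (simp add: J_LA_def p_def a_def)
    ultimately have p: "p < l0" by simp
    \<comment> \<open>Half of the slack \<open>l0 - p\<close> is granted to the error in \<open>A x\<close>; the added \<open>1\<close> covers a zero
      column.\<close>
    define \<eta> where "\<eta> = (l0 - p) / (2 * (norm a + 1))"
    have na: "norm a + 1 > 0" by (smt (verit) norm_ge_zero)
    have \<eta>: "\<eta> > 0" using p na by (simp add: \<eta>_def)
    have "norm a * \<eta> < (norm a + 1) * \<eta>" using \<eta> by simp
    also have "\<dots> = (l0 - p) / 2"
      using nonzero_mult_div_cancel_left[of "norm a + 1" "(l0 - p) / 2"] na
      by (simp only: \<eta>_def) (simp add: field_simps)
    finally have "p + norm a * \<eta> < l0" using p by (simp add: field_simps)
    moreover have "((\<lambda>q. snd q - (p + norm a * (norm (fst q - b0) + \<eta>))) \<longlongrightarrow>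
        snd (b0, l0) - (p + norm a * (norm (fst (b0, l0) - b0) + \<eta>))) (nhds (b0, l0))"
      by (intro tendsto_intros filterlim_ident)
    ultimately have "\<forall>\<^sub>F q in nhds (b0, l0). 0 < snd q - (p + norm a * (norm (fst q - b0) + \<eta>))"
      by (intro order_tendstoD(1)) auto
    with eventually_lasso_image_near[OF l0 x0 \<eta>] show ?thesis
    proof eventually_elim
      case (elim q)
      obtain b l where q: "q = (b, l)" by fastforce
      have "0 \<le> p + norm a * (norm (b - b0) + \<eta>)"
        using \<eta> by (simp add: p_def)
      with elim q have l: "l > 0" by simp
      show ?case
      proof
        fix x assume x: "x \<in> lasso_sol A q"
        have "b - A *v x = (b0 - A *v x0) + ((b - b0) - A *v (x - x0))"
          by (simp add: matrix_vector_mult_diff_distrib)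
        then have "a \<bullet> (b - A *v x) = a \<bullet> (b0 - A *v x0) + a \<bullet> ((b - b0) - A *v (x - x0))"
          by (simp only: inner_add_right)
        also have "\<bar>\<dots>\<bar> \<le> p + norm a * norm ((b - b0) - A *v (x - x0))"
          unfolding p_def using Cauchy_Schwarz_ineq2 abs_triangle_ineq add_left_mono order_trans
          by meson
        also have "\<dots> \<le> p + norm a * (norm (b - b0) + \<eta>)"
          using elim(1) x norm_triangle_ineq4[of "b - b0" "A *v (x - x0)"]
          by (intro add_left_mono mult_left_mono) (force, simp)
        also have "\<dots> < l" using elim q by simp
        finally have "\<bar>a \<bullet> (b - A *v x)\<bar> < l" .
        moreover have "x $ i * (a \<bullet> (b - A *v x)) = l * \<bar>x $ i\<bar>"
          using x unfolding q lasso_sol_coordinatewise[OF l] a_def by blast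
        then have "\<bar>x $ i\<bar> * \<bar>a \<bullet> (b - A *v x)\<bar> = \<bar>x $ i\<bar> * l"
          using l by (metis abs_abs abs_mult abs_of_pos mult.commute)
        ultimately show "x $ i = 0" by auto
      qed
    qed
  qed
  then have "\<forall>\<^sub>F q in nhds (b0, l0).
      \<forall>i. i \<notin> J_LA A b0 l0 x0 \<longrightarrow> (\<forall>x\<in>lasso_sol A q. x $ i = 0)"
    by (intro eventually_all_finite) (auto intro: always_eventually)
  then show ?thesis by (auto elim!: eventually_mono)
qed

section \<open>Linear independence of columns\<close>

definition supported_on :: "'n set \<Rightarrow> (real ^ 'n) set" where
  "supported_on I = {d. \<forall>i. i \<notin> I \<longrightarrow> d $ i = 0}"

lemma subspace_supported_on: "subspace (supported_on I)"
  by (auto simp: supported_on_def subspace_def)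

lemma matrix_vector_mult_supported_on:
  assumes "d \<in> supported_on I"
  shows "A *v d = (\<Sum>i\<in>I. d $ i *\<^sub>R column i A)"
proof -
  have "A *v d = (\<Sum>i\<in>UNIV. d $ i *\<^sub>R column i A)"
    by (simp add: matrix_mult_sum scalar_mult_eq_scaleR)
  also have "\<dots> = (\<Sum>i\<in>I. d $ i *\<^sub>R column i A)"
    using assms by (intro sum.mono_neutral_right) (auto simp: supported_on_def)
  finally show ?thesis .
qed

text \<open>Extending by zero identifies the extensional functions on \<open>I\<close> with the vectors supported
  on \<open>I\<close>.\<close>

lemma kernel_trivial_iff:
  "col_submatrix_kernel A I = {\<lambda>i\<in>I. 0} \<longleftrightarrow> (\<forall>d\<in>supported_on I. A *v d = 0 \<longrightarrow> d = 0)"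
proof
  assume K: "col_submatrix_kernel A I = {\<lambda>i\<in>I. 0}"
  show "\<forall>d\<in>supported_on I. A *v d = 0 \<longrightarrow> d = 0"
  proof (intro ballI impI)
    fix d assume d: "d \<in> supported_on I" and "A *v d = 0"
    then have "(\<lambda>i\<in>I. d $ i) \<in> col_submatrix_kernel A I"
      by (simp add: col_submatrix_kernel_def col_submatrix_def
          matrix_vector_mult_supported_on[OF d])
    then have "(\<lambda>i\<in>I. d $ i) = (\<lambda>i\<in>I. 0)" using K by simp
    then have "d $ i = 0" if "i \<in> I" for i using that by (metis restrict_apply')
    with d show "d = 0" by (auto simp: vec_eq_iff supported_on_def)
  qed
next
  assume *: "\<forall>d\<in>supported_on I. A *v d = 0 \<longrightarrow> d = 0"
  show "col_submatrix_kernel A I = {\<lambda>i\<in>I. 0}"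
  proof (intro equalityI subsetI)
    fix y assume y: "y \<in> col_submatrix_kernel A I"
    define d where "d = (\<chi> i. if i \<in> I then y i else 0)"
    have d: "d \<in> supported_on I" by (simp add: d_def supported_on_def)
    have "A *v d = (\<Sum>i\<in>I. y i *\<^sub>R col_submatrix A I i)"
      unfolding matrix_vector_mult_supported_on[OF d]
      by (intro sum.cong) (auto simp: d_def col_submatrix_def)
    then have "A *v d = 0" using y by (simp add: col_submatrix_kernel_def)
    with * d have "d = 0" by blast
    then have "y i = 0" if "i \<in> I" for i
    proof -
      have "y i = d $ i" using that by (simp add: d_def)
      then show ?thesis using \<open>d = 0\<close> by simp
    qed
    moreover have "y \<in> extensional I"
      using y by (simp add: col_submatrix_kernel_def PiE_def)
    ultimately show "y \<in> {\<lambda>i\<in>I. 0}" by (auto simp: extensional_def fun_eq_iff)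
  qed (simp add: col_submatrix_kernel_def)
qed

text \<open>Independence of the set of columns alone would not see repeated columns. Rank equal to
  \<open>card I\<close> rules them out, since the dimension is at most the number of distinct columns.\<close>

lemma full_column_rank_iff_independent:
  "full_column_rank A I \<longleftrightarrow>
     inj_on (\<lambda>i. column i A) I \<and> independent ((\<lambda>i. column i A) ` I)"
proof -
  let ?c = "\<lambda>i. column i A"
  have im: "col_submatrix A I ` I = ?c ` I" by (simp add: col_submatrix_def)
  show ?thesis
    unfolding full_column_rank_def im dim_span
  proof (intro iffI conjI; (elim conjE)?)
    assume d: "dim (?c ` I) = card I"
    then have "card (?c ` I) = card I"
      using dim_le_card'[of "?c ` I"] card_image_le[of I ?c] by simp
    then show "inj_on ?c I" by (simp add: inj_on_iff_eq_card)
  next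
    assume d: "dim (?c ` I) = card I"
    then have c: "card (?c ` I) = card I"
      using dim_le_card'[of "?c ` I"] card_image_le[of I ?c] by simp
    show "independent (?c ` I)"
      by (rule card_le_dim_spanning[OF subset_refl span_superset])
        (simp_all add: c d)
  next
    assume "inj_on ?c I" "independent (?c ` I)"
    then show "dim (?c ` I) = card I"
      by (simp add: dim_eq_card_independent card_image)
  qed
qed

lemma full_column_rank_iff:
  "full_column_rank A I \<longleftrightarrow> (\<forall>d\<in>supported_on I. A *v d = 0 \<longrightarrow> d = 0)"
proof
  let ?c = "\<lambda>i. column i A"
  assume "full_column_rank A I"
  then have inj: "inj_on ?c I" and ind: "independent (?c ` I)"
    by (auto simp: full_column_rank_iff_independent)
  show "\<forall>d\<in>supported_on I. A *v d = 0 \<longrightarrow> d = 0"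
  proof (intro ballI impI)
    fix d assume d: "d \<in> supported_on I" and Ad: "A *v d = 0"
    define u where "u v = d $ (inv_into I ?c v)" for v
    have "(\<Sum>v\<in>?c ` I. u v *\<^sub>R v) = (\<Sum>i\<in>I. d $ i *\<^sub>R ?c i)"
      unfolding sum.reindex[OF inj] by (intro sum.cong) (simp_all add: u_def inv_into_f_f[OF inj])
    also have "\<dots> = 0" using Ad matrix_vector_mult_supported_on[OF d] by metis
    finally have "u v = 0" if "v \<in> ?c ` I" for v
      using ind that by (auto simp: independent_explicit)
    then have "d $ i = 0" if "i \<in> I" for i
      using that inv_into_f_f[OF inj that] by (force simp: u_def)
    with d show "d = 0" by (auto simp: vec_eq_iff supported_on_def)
  qed
next
  let ?c = "\<lambda>i. column i A"
  assume *: "\<forall>d\<in>supported_on I. A *v d = 0 \<longrightarrow> d = 0"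
  have inj: "inj_on ?c I"
  proof (rule inj_onI, rule ccontr)
    fix i j assume ij: "i \<in> I" "j \<in> I" "?c i = ?c j" "i \<noteq> j"
    define d :: "real ^ 'a" where "d = axis i 1 - axis j 1"
    have "d \<in> supported_on I" using ij by (auto simp: d_def supported_on_def axis_def)
    moreover have "A *v d = 0"
      using ij by (simp add: d_def matrix_vector_mult_diff_distrib matrix_vector_mult_basis)
    ultimately have "d = 0" using * by blast
    then have "d $ i = 0" by simp
    with ij show False by (simp add: d_def axis_def)
  qed
  moreover have "independent (?c ` I)"
    unfolding independent_explicit
  proof (intro conjI allI impI ballI)
    fix u :: "real ^ 'b \<Rightarrow> real" and v assume u: "(\<Sum>v\<in>?c ` I. u v *\<^sub>R v) = 0" and v: "v \<in> ?c ` I"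
    define d where "d = (\<chi> i. if i \<in> I then u (?c i) else 0)"
    have d: "d \<in> supported_on I" by (simp add: d_def supported_on_def)
    have "A *v d = 0"
      using u unfolding matrix_vector_mult_supported_on[OF d] sum.reindex[OF inj]
      by (simp add: d_def)
    with * d have "d = 0" by blast
    moreover obtain i where "i \<in> I" "v = ?c i" using v by blast
    then have "u v = d $ i" by (simp add: d_def)
    ultimately show "u v = 0" by simp
  qed simp
  ultimately show "full_column_rank A I" by (simp add: full_column_rank_iff_independent)
qed

section \<open>Single-valuedness and the kernel\<close>

text \<open>Differences of nearby solutions lie in the subspace of vectors supported on \<open>J_LA\<close>, where
  injectivity of \<open>A\<close> gives \<open>c |d| \<le> |A d|\<close>. The monotonicity bound is then quadratic in \<open>|d|\<close>
  on the left and linear in \<open>|d|\<close> on the right, so one factor cancels.\<close>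

lemma lasso_locally_lipschitz_if_kernel_trivial:
  fixes A :: "real ^ 'n ^ 'm"
  assumes l0: "l0 > 0" and x0: "x0 \<in> lasso_sol A (b0, l0)"
    and inj: "\<forall>d\<in>supported_on (J_LA A b0 l0 x0). A *v d = 0 \<longrightarrow> d = 0"
  shows "locally_single_valued_lipschitz (UNIV \<times> {0<..}) (lasso_sol A) (b0, l0)"
proof -
  let ?V = "supported_on (J_LA A b0 l0 x0)"
  obtain c where c: "c > 0" "\<forall>d\<in>?V. c * norm d \<le> norm (A *v d)"
    using injective_imp_isometric[OF closed_subspace[OF subspace_supported_on]
        subspace_supported_on matrix_vector_mul_bounded_linear inj]
    by (auto simp: mult.commute)
  obtain K where K: "K > 0" "\<And>d. norm (A *v d) \<le> norm d * K"
    using bounded_linear.pos_bounded[OF matrix_vector_mul_bounded_linear[of A]] by auto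
  define L where "L = (K + real CARD('n)) / c\<^sup>2"
  from eventually_lasso_support[OF l0 x0] eventually_snd_pos[OF l0, of b0]
  have "\<forall>\<^sub>F q in nhds (b0, l0). lasso_sol A q \<subseteq> ?V \<and> snd q > 0"
    by eventually_elim (auto simp: supported_on_def)
  then obtain U where U: "open U" "(b0, l0) \<in> U"
      "\<And>q. q \<in> U \<Longrightarrow> lasso_sol A q \<subseteq> ?V" "\<And>q. q \<in> U \<Longrightarrow> snd q > 0"
    unfolding eventually_nhds by blast
  have est: "norm (x - x') \<le> L * dist q q'"
    if q: "q \<in> U" "q' \<in> U" "x \<in> lasso_sol A q" "x' \<in> lasso_sol A q'" for q q' x x'
  proof -
    obtain b l b' l' where qs: "q = (b, l)" "q' = (b', l')" by fastforce
    define D where "D = dist q q'"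
    define d where "d = x - x'"
    have d: "d \<in> ?V"
      using q U(3) subspace_diff[OF subspace_supported_on] unfolding d_def by blast
    have db: "norm (b - b') \<le> D" and dl: "\<bar>l - l'\<bar> \<le> D"
      using dist_fst_le[of q q'] dist_snd_le[of q q']
      by (simp_all add: D_def qs dist_norm)
    have D: "0 \<le> D" by (simp add: D_def)
    have "c\<^sup>2 * (norm d)\<^sup>2 \<le> (norm (A *v d))\<^sup>2"
      using c d by (metis power_mult_distrib power_mono mult_nonneg_nonneg norm_ge_zero less_imp_le)
    also have "\<dots> \<le> norm (b - b') * norm (A *v d) + \<bar>l - l'\<bar> * \<bar>l1_norm x - l1_norm x'\<bar>"
      using lasso_sol_monotonicity[of l x A b l' x' b'] q U(4)[OF q(1)] U(4)[OF q(2)]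
      by (simp add: qs d_def)
    also have "\<dots> \<le> D * (norm d * K) + D * (real CARD('n) * norm d)"
      using db dl D K(2)[of d] abs_l1_norm_diff_le[of x x'] l1_norm_le_card_norm[of d]
      by (intro add_mono mult_mono) (auto simp: d_def)
    finally have "(c\<^sup>2 * norm d) * norm d \<le> ((K + real CARD('n)) * D) * norm d"
      by (simp add: power2_eq_square algebra_simps)
    then have "c\<^sup>2 * norm d \<le> (K + real CARD('n)) * D"
      using K D by (cases "d = 0") auto
    then have "norm d \<le> L * D"
      using c by (simp add: L_def field_simps)
    then show ?thesis by (simp add: d_def D_def)
  qed
  define s where "s q = (SOME x. x \<in> lasso_sol A q)" for q
  have s: "s q \<in> lasso_sol A q" if "q \<in> U" for q
  proof -
    have "lasso_sol A q \<noteq> {}"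
      using lasso_sol_nonempty[of "snd q" A "fst q"] U(4)[OF that] by simp
    then show ?thesis unfolding s_def by (auto intro: someI)
  qed
  have "L-lipschitz_on U s"
  proof (rule lipschitz_onI)
    show "0 \<le> L" using K by (simp add: L_def)
  qed (use est s in \<open>auto simp: dist_norm\<close>)
  moreover have "lasso_sol A q = {s q}" if "q \<in> U" for q
    using est[OF that that] s[OF that] by fastforce
  moreover have "U \<subseteq> UNIV \<times> {0<..}" using U(4) by fastforce
  ultimately show ?thesis
    unfolding locally_single_valued_lipschitz_def using U by blast
qed

text \<open>The degenerate case is that of indices in \<open>J_LA\<close> with \<open>x0\<^sub>i = 0\<close>, where a kernel
  direction may violate the sign conditions at \<open>x0\<close> itself. Moving \<open>x0\<close> in the direction of the
  required signs, and \<open>b0\<close> by the image of that direction, makes all these coordinates nonzero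
  while keeping the residual; nonuniqueness then appears at a nearby parameter.\<close>

lemma kernel_trivial_if_lasso_sol_singleton:
  assumes l0: "l0 > 0" and x0: "x0 \<in> lasso_sol A (b0, l0)"
    and U: "open U" "(b0, l0) \<in> U" and single: "\<And>q. q \<in> U \<Longrightarrow> \<exists>z. lasso_sol A q = {z}"
    and d: "d \<in> supported_on (J_LA A b0 l0 x0)" and Ad: "A *v d = 0"
  shows "d = 0"
proof -
  define J where "J = J_LA A b0 l0 x0"
  define p where "p i = column i A \<bullet> (b0 - A *v x0)" for i
  define w where "w = (\<chi> i. if i \<in> J then sgn (p i) else 0)"
  have opt: "\<bar>p i\<bar> \<le> l0" "x0 $ i * p i = l0 * \<bar>x0 $ i\<bar>" for i
    using x0 unfolding lasso_sol_coordinatewise[OF l0] p_def by auto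
  have J: "i \<in> J \<longleftrightarrow> \<bar>p i\<bar> = l0" for i by (simp add: J_def J_LA_def p_def)
  have "((\<lambda>t. (b0 + t *\<^sub>R (A *v w), l0)) \<longlongrightarrow> (b0 + 0 *\<^sub>R (A *v w), l0)) (at_right 0)"
    by (intro tendsto_intros)
  then have "\<forall>\<^sub>F t in at_right 0. (b0 + t *\<^sub>R (A *v w), l0) \<in> U"
    using U by (intro topological_tendstoD) auto
  then have "\<forall>\<^sub>F t in at_right (0::real). (b0 + t *\<^sub>R (A *v w), l0) \<in> U \<and> t > 0"
    by (simp add: eventually_conj eventually_at_right_less)
  then obtain t where t: "(b0 + t *\<^sub>R (A *v w), l0) \<in> U" "t > 0"
    using eventually_happens'[OF trivial_limit_at_right_real] by blast
  define b where "b = b0 + t *\<^sub>R (A *v w)"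
  \<comment> \<open>Small enough that adding \<open>e d\<close> cannot flip a sign secured by the shift by \<open>t w\<close>.\<close>
  define e where "e = t / (norm d + 1)"
  have nd: "norm d + 1 > 0" by (smt (verit) norm_ge_zero)
  have e: "e > 0" using t nd by (simp add: e_def)
  have ed: "e * \<bar>d $ i\<bar> \<le> t" for i
  proof -
    have "e * \<bar>d $ i\<bar> \<le> e * (norm d + 1)"
      using e component_le_norm_cart[of d i] by (intro mult_left_mono) auto
    then show ?thesis using nd by (simp add: e_def)
  qed
  have sol: "x0 + t *\<^sub>R w + r *\<^sub>R d \<in> lasso_sol A (b, l0)" if r: "r = 0 \<or> r = e" for r
  proof -
    define x where "x = x0 + t *\<^sub>R w + r *\<^sub>R d"
    have res: "b - A *v x = b0 - A *v x0"
      by (simp add: b_def x_def matrix_vector_right_distrib matrix_vector_mult_scaleR Ad)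
    have "x $ i * p i = l0 * \<bar>x $ i\<bar>" for i
    proof (cases "i \<in> J")
      case False
      then have "x $ i = x0 $ i"
        using d by (simp add: x_def w_def supported_on_def J_def)
      then show ?thesis using opt by simp
    next
      case True
      define \<sigma> where "\<sigma> = sgn (p i)"
      have p: "p i = l0 * \<sigma>" and \<sigma>: "\<sigma> = 1 \<or> \<sigma> = -1"
        using True J l0 unfolding \<sigma>_def by (auto simp: sgn_if)
      have rd: "\<bar>r * d $ i\<bar> \<le> t"
        using r ed[of i] t e by (auto simp: abs_mult)
      have "x0 $ i * \<sigma> = \<bar>x0 $ i\<bar>" using opt(2)[of i] l0 p by simp
      then have "0 \<le> \<sigma> * x $ i"
        using \<sigma> rd True by (auto simp: x_def w_def \<sigma>_def[symmetric])
      then show ?thesis using \<sigma> p by auto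
    qed
    then show ?thesis
      unfolding lasso_sol_coordinatewise[OF l0] x_def[symmetric] res p_def[symmetric]
      using opt by blast
  qed
  obtain z where "lasso_sol A (b, l0) = {z}" using single t b_def by blast
  with sol[of 0] sol[of e] have "e *\<^sub>R d = 0" by simp
  with e show "d = 0" by simp
qed

theorem theorem4p3:
  fixes A :: "real ^ 'n ^ 'm" and b0 :: "real ^ 'm" and l0 :: real and x0 :: "real ^ 'n"
  assumes "l0 > 0"
    and "x0 \<in> lasso_sol A (b0, l0)"
  shows "(locally_single_valued_lipschitz (UNIV \<times> {0<..}) (lasso_sol A) (b0, l0)
            \<longleftrightarrow> full_column_rank A (J_LA A b0 l0 x0))
       \<and> (full_column_rank A (J_LA A b0 l0 x0)
            \<longleftrightarrow> col_submatrix_kernel A (J_LA A b0 l0 x0) = {\<lambda>i\<in>J_LA A b0 l0 x0. 0})"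
proof -
  have "\<forall>d\<in>supported_on (J_LA A b0 l0 x0). A *v d = 0 \<longrightarrow> d = 0"
    if S: "locally_single_valued_lipschitz (UNIV \<times> {0<..}) (lasso_sol A) (b0, l0)"
  proof -
    obtain U s where "open U" "(b0, l0) \<in> U" "\<forall>q\<in>U. lasso_sol A q = {s q}"
      using S unfolding locally_single_valued_lipschitz_def by blast
    then show ?thesis
      using kernel_trivial_if_lasso_sol_singleton[OF assms, of U] by blast
  qed
  then show ?thesis
    using lasso_locally_lipschitz_if_kernel_trivial[OF assms]
    unfolding full_column_rank_iff kernel_trivial_iff by blast
qed

end
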